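(* Let $I_R,N\ge1$ be integers, $\mathcal{I}=\{1,\dots,I_R\}$, let $\rho>0$, $u>0$, $\eta>0$ be real numbers, let $\mathbf{G}\in\mathbb{C}^{I_R\times N}$ and $\mathbf{w}\in\mathbb{C}^{N\times 1}$ be given, and let $\mathbf{g}=\mathbf{G}\mathbf{w}$ with $i$-th entry $g_i$. Let $\mathbf{x}_m,\boldsymbol{\mu}_m\in\mathbb{C}^{I_R+1}$, $m=0,1,2$, be given vectors with $i$-th entries $x_{m,i}$ and $\mu_{m,i}$. Consider the optimization problem over $\mathbf{S}=\mathrm{diag}(s_1,\dots,s_{I_R})$ and $\bar{\boldsymbol{\theta}}=[\bar\theta_1,\dots,\bar\theta_{I_R+1}]^T\in\mathbb{C}^{I_R+1}$: $$\min_{\mathbf{S},\,\bar{\boldsymbol{\theta}}}\ E_{\mathrm{RIS}}(\mathbf{w},\mathbf{S})+\rho\sum_{m=0}^{2}\bigl\|\mathbf{x}_m-\bar{\boldsymbol{\theta}}+\boldsymbol{\mu}_m\bigr\|^2$$ $$\text{subject to}\quad s_i\in\{0,1\}\ \ \forall i\in\mathcal{I},\qquad |\bar\theta_i|^2=s_i\ \ \forall i\in\mathcal{I},\qquad |\bar\theta_{I_R+1}|^2=1 .$$ For $i\in\mathcal{I}$ put $$J_i=\eta|g_i|^2+u+3\rho-2\rho\left|\sum_{m=0}^{2}(x_{m,i}+\mu_{m,i})\right| .$$ Then an optimal solution of this problem is given by $$s_i=\begin{cases}0,&\text{if }J_i>0,\\ 1,&\text{otherwise,}\end{cases}\qquad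 \bar\theta_i=s_i\exp\left(j\arg\left(\sum_{m=0}^{2}(x_{m,i}+\mu_{m,i})\right)\right)\qquad\forall i\in\mathcal{I},$$ $$\bar\theta_{I_R+1}=\exp\left(j\arg\left(\sum_{m=0}^{2}(x_{m,I_R+1}+\mu_{m,I_R+1})\right)\right).$$
   Context: Here $j$ is the imaginary unit, $\|\cdot\|$ is the Euclidean norm, $(\cdot)^H$ is conjugate transpose, $\mathbf{I}$ is the $I_R\times I_R$ identity matrix, and $\arg$ denotes the argument of a complex number (with $\arg 0$ taken to be an arbitrary fixed real number). The power consumption of the reconfigurable intelligent surface (RIS) is $$E_{\mathrm{RIS}}(\mathbf{w},\mathbf{S})=\mathrm{tr}(\mathbf{S})\,u-\eta\,\mathrm{tr}\bigl((\mathbf{I}-\mathbf{S})\mathbf{G}\mathbf{w}\mathbf{w}^H\mathbf{G}^H(\mathbf{I}-\mathbf{S})\bigr),$$ where $u$ is the power consumed for phase control of one reflecting element and $\eta$ is the energy harvesting efficiency. In the source, $\mathbf{x}_m$ and $\boldsymbol{\mu}_m$ are the iterates $\mathbf{x}_m^{(n)},\boldsymbol{\mu}_m^{(n)}$ of an ADMM procedure, and $\mathbf{S},\bar{\boldsymbol{\theta}}$ are the next global iterates. *)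

theory Defs
  imports "HOL-Analysis.Analysis"
begin

definition conj_transpose :: "complex^'n^'m \<Rightarrow> complex^'m^'n" where
  "conj_transpose A = (\<chi> i j. cnj (A $ j $ i))"

definition diag :: "real^'r \<Rightarrow> complex^'r^'r" where
  "diag s = (\<chi> i j. if i = j then complex_of_real (s $ i) else 0)"

definition ris_power ::
  "real \<Rightarrow> real \<Rightarrow> complex^'n^'r \<Rightarrow> complex^1^'n \<Rightarrow> complex^'r^'r \<Rightarrow> complex" where
  "ris_power u \<eta> G w S =
     trace S * of_real u
     - of_real \<eta> * trace ((mat 1 - S) ** G ** w ** conj_transpose w ** conj_transpose G ** (mat 1 - S))"

lemma conj_transpose_mult: "conj_transpose (A ** B) = conj_transpose B ** conj_transpose A"
  by (simp add: conj_transpose_def matrix_matrix_mult_def vec_eq_iff mult.commute)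

lemma trace_mult_conj_transpose_real: "trace (A ** conj_transpose A) \<in> \<real>"
  by (auto simp: trace_def matrix_matrix_mult_def conj_transpose_def complex_mult_cnj
           intro!: sum_in_Reals)

text \<open>The power consumption is real on the diagonal matrices considered, so that taking the
  real part in the objective below loses nothing.\<close>

lemma ris_power_diag_real: "ris_power u \<eta> G w (diag s) \<in> \<real>"
proof -
  let ?D = "mat 1 - diag s"
  have D: "conj_transpose ?D = ?D"
    by (simp add: conj_transpose_def diag_def mat_def vec_eq_iff)
  have "?D ** G ** w ** conj_transpose w ** conj_transpose G ** ?D
      = (?D ** G ** w) ** conj_transpose (?D ** G ** w)"
    by (simp add: conj_transpose_mult D matrix_mul_assoc)
  moreover have "trace (diag s) \<in> \<real>"
    by (auto simp: trace_def diag_def intro!: sum_in_Reals)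
  ultimately show ?thesis
    unfolding ris_power_def by (simp add: trace_mult_conj_transpose_real)
qed

text \<open>Vectors with \<open>I\<^sub>R + 1\<close> entries are indexed by \<^typ>\<open>'r option\<close>, where \<^typ>\<open>'r\<close> has
  \<open>I\<^sub>R\<close> elements: \<open>Some i\<close> stands for \<open>i \<in> {1..I\<^sub>R}\<close> and \<open>None\<close> for the last index \<open>I\<^sub>R + 1\<close>.\<close>

definition feasible :: "complex^'r^'r \<Rightarrow> complex^('r option) \<Rightarrow> bool" where
  "feasible S \<theta> \<longleftrightarrow>
     (\<exists>s. S = diag s \<and> (\<forall>i. s $ i \<in> {0, 1}) \<and> (\<forall>i. (cmod (\<theta> $ Some i))\<^sup>2 = s $ i))
     \<and> (cmod (\<theta> $ None))\<^sup>2 = 1"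

definition objective ::
  "real \<Rightarrow> real \<Rightarrow> real \<Rightarrow> complex^'n^'r \<Rightarrow> complex^1^'n
   \<Rightarrow> (nat \<Rightarrow> complex^('r option)) \<Rightarrow> (nat \<Rightarrow> complex^('r option))
   \<Rightarrow> complex^'r^'r \<Rightarrow> complex^('r option) \<Rightarrow> real" where
  "objective \<rho> u \<eta> G w x \<mu> S \<theta> =
     Re (ris_power u \<eta> G w S) + \<rho> * (\<Sum>m=0..2. (norm (x m - \<theta> + \<mu> m))\<^sup>2)"

text \<open>The argument function with \<open>a\<close> as its value at 0, where the library's \<^const>\<open>Arg\<close> has 0.\<close>

definition argument :: "real \<Rightarrow> complex \<Rightarrow> real" where
  "argument a z = (if z = 0 then a else Arg z)"

end

(* The objective splits into a sum over the coordinates, plus a term for the last index. For a fixed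
   coordinate with t = theta_i and c = sum_m (x_{m,i} + mu_{m,i}), the penalty depends on t only
   through 3 |t|^2 - 2 Re (cnj t * c), which on |t| = 1 is smallest at t = exp (j arg c), with value
   3 - 2 |c|, and vanishes at t = 0. Hence J_i is exactly the difference between the best cost
   with s_i = 1 and the cost with s_i = 0. *)

theory Submission
  imports Defs
begin

lemma Re_trace_diag: "Re (trace (diag s)) = (\<Sum>i\<in>UNIV. s $ i)"
  by (simp add: trace_def diag_def)

lemma Re_trace_mult_conj_transpose:
  fixes A :: "complex^1^'r"
  shows "Re (trace (A ** conj_transpose A)) = (\<Sum>i\<in>UNIV. (cmod (A $ i $ 1))\<^sup>2)"
  by (simp add: trace_def matrix_matrix_mult_def conj_transpose_def complex_norm_square [symmetric]
           del: of_real_power)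

lemma one_minus_diag_mult_nth:
  fixes g :: "complex^1^'r"
  shows "((mat 1 - diag s) ** g) $ i $ 1 = of_real (1 - s $ i) * g $ i $ 1"
  by (simp add: matrix_matrix_mult_def mat_def diag_def left_diff_distrib sum_subtractf
      if_distrib [of "\<lambda>a. a * _"] cong: if_cong)

text \<open>Since \<open>mat 1 - diag s\<close> is Hermitian, the matrix under the trace is A A^H
  for the single column A = (I - S) G w, so its trace is the squared norm of that column.\<close>

lemma Re_ris_power_diag:
  "Re (ris_power u \<eta> G w (diag s))
     = (\<Sum>i\<in>UNIV. u * s $ i - \<eta> * ((1 - s $ i)\<^sup>2 * (cmod ((G ** w) $ i $ 1))\<^sup>2))"
proof -
  let ?D = "mat 1 - diag s"
  have D: "conj_transpose ?D = ?D"
    by (simp add: conj_transpose_def diag_def mat_def vec_eq_iff)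
  have "?D ** G ** w ** conj_transpose w ** conj_transpose G ** ?D
      = (?D ** (G ** w)) ** conj_transpose (?D ** (G ** w))"
    by (simp add: conj_transpose_mult D matrix_mul_assoc)
  then have "Re (ris_power u \<eta> G w (diag s))
      = (\<Sum>i\<in>UNIV. s $ i) * u
        - \<eta> * (\<Sum>i\<in>UNIV. (cmod ((?D ** (G ** w)) $ i $ 1))\<^sup>2)"
    unfolding ris_power_def by (simp add: Re_trace_diag Re_trace_mult_conj_transpose)
  then show ?thesis
    by (simp add: one_minus_diag_mult_nth norm_mult power_mult_distrib sum_subtractf
        sum_distrib_left mult.commute flip: of_real_diff)
qed

lemma norm_square_vec_option:
  fixes v :: "complex^('r::finite option)"
  shows "(norm v)\<^sup>2 = (cmod (v $ None))\<^sup>2 + (\<Sum>i\<in>UNIV. (cmod (v $ Some i))\<^sup>2)"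
  by (simp add: norm_vec_def L2_set_def sum_nonneg UNIV_option_conv sum.reindex)

text \<open>Separability: the \<open>i\<close>-th summand involves only \<open>s $ i\<close> and
  \<open>\<phi> $ Some i\<close>, and the constraints couple no two indices, so each index can be
  minimized on its own.\<close>

lemma objective_diag:
  "objective \<rho> u \<eta> G w x \<mu> (diag s) \<phi>
     = (\<Sum>i\<in>UNIV. u * s $ i - \<eta> * ((1 - s $ i)\<^sup>2 * (cmod ((G ** w) $ i $ 1))\<^sup>2)
          + \<rho> * (\<Sum>m=0..2. (cmod (x m $ Some i + \<mu> m $ Some i - \<phi> $ Some i))\<^sup>2))
       + \<rho> * (\<Sum>m=0..2. (cmod (x m $ None + \<mu> m $ None - \<phi> $ None))\<^sup>2)"
proof -
  have "(\<Sum>m=0..2. (norm (x m - \<phi> + \<mu> m))\<^sup>2)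
      = (\<Sum>m=0..2. (cmod (x m $ None + \<mu> m $ None - \<phi> $ None))\<^sup>2)
        + (\<Sum>i\<in>UNIV. \<Sum>m=0..2. (cmod (x m $ Some i + \<mu> m $ Some i - \<phi> $ Some i))\<^sup>2)"
    by (subst sum.swap) (simp add: norm_square_vec_option sum.distrib algebra_simps)
  then show ?thesis
    by (simp add: objective_def Re_ris_power_diag sum.distrib sum_distrib_left distrib_left)
qed

lemma sum_cmod_diff_square:
  "(\<Sum>m\<in>A. (cmod (c m - t))\<^sup>2)
     = (\<Sum>m\<in>A. (cmod (c m))\<^sup>2) + of_nat (card A) * (cmod t)\<^sup>2 - 2 * Re (cnj t * (\<Sum>m\<in>A. c m))"
proof -
  have "(cmod (c m - t))\<^sup>2 = (cmod (c m))\<^sup>2 + (cmod t)\<^sup>2 - 2 * Re (cnj t * c m)" for m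
    unfolding cmod_power2 by (simp add: power2_eq_square algebra_simps)
  then show ?thesis
    by (simp only: sum.distrib sum_subtractf sum_distrib_left [symmetric] Re_sum [symmetric]
        sum_constant)
qed

lemma Re_cnj_mult_le:
  assumes "cmod t = 1"
  shows "Re (cnj t * c) \<le> cmod c"
  using complex_Re_le_cmod [of "cnj t * c"] assms by (simp add: norm_mult)

text \<open>Rotating \<open>c\<close> back by its own argument puts it on the nonnegative real axis,
  which gives equality in the bound \<open>Re_cnj_mult_le\<close>. At \<open>c = 0\<close> both
  sides vanish for every \<open>a\<close>.\<close>

lemma cnj_exp_argument_mult: "cnj (exp (\<i> * of_real (argument a c))) * c = of_real (cmod c)"
proof (cases "c = 0")
  case False
  have "c = of_real (cmod c) * exp (\<i> * of_real (Arg c))"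
    using Arg_eq [OF False] .
  then have "cnj (exp (\<i> * of_real (Arg c))) * c
      = of_real (cmod c) * (cnj (exp (\<i> * of_real (Arg c))) * exp (\<i> * of_real (Arg c)))"
    by (metis mult.left_commute)
  also have "cnj (exp (\<i> * of_real (Arg c))) * exp (\<i> * of_real (Arg c)) = 1"
    by (simp add: exp_cnj flip: exp_add)
  finally show ?thesis using False by (simp add: argument_def)
qed simp

text \<open>Between points of modulus 1 the penalty differs only in its cross term, which the
  aligned phase maximizes.\<close>

lemma penalty_argument_le:
  fixes c :: "nat \<Rightarrow> complex"
  assumes "cmod t = 1"
  shows "(\<Sum>m\<in>A. (cmod (c m - exp (\<i> * of_real (argument a (\<Sum>m\<in>A. c m)))))\<^sup>2)
           \<le> (\<Sum>m\<in>A. (cmod (c m - t))\<^sup>2)"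
  using Re_cnj_mult_le [OF assms, of "\<Sum>m\<in>A. c m"] assms
  by (simp only: sum_cmod_diff_square cnj_exp_argument_mult) simp

text \<open>Optimality at one index: \<open>h\<close> stands for |g_i|^2, the pair \<open>s\<close>,
  \<open>t'\<close> is the claimed solution and \<open>r\<close>, \<open>t\<close> an arbitrary
  feasible competitor.\<close>

lemma element_cost_le:
  fixes c :: "nat \<Rightarrow> complex"
  assumes "\<rho> > 0" and "r \<in> {0, 1}" and "(cmod t)\<^sup>2 = r"
    and J: "J = \<eta> * h + u + 3 * \<rho> - 2 * \<rho> * cmod (\<Sum>m=0..2. c m)"
    and s: "s = (if J > 0 then 0 else 1)"
    and t': "t' = of_real s * exp (\<i> * of_real (argument a (\<Sum>m=0..2. c m)))"
  shows "u * s - \<eta> * ((1 - s)\<^sup>2 * h) + \<rho> * (\<Sum>m=0..2. (cmod (c m - t'))\<^sup>2)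
           \<le> u * r - \<eta> * ((1 - r)\<^sup>2 * h) + \<rho> * (\<Sum>m=0..2. (cmod (c m - t))\<^sup>2)"
proof -
  define B where "B = (\<Sum>m=0..2. (cmod (c m))\<^sup>2)"
  let ?C = "\<Sum>m=0..2. c m"
  let ?e = "exp (\<i> * of_real (argument a ?C))"
  have zero: "(\<Sum>m=0..2. (cmod (c m - 0))\<^sup>2) = B"
    by (simp add: B_def)
  have opt: "(\<Sum>m=0..2. (cmod (c m - ?e))\<^sup>2) = B + 3 - 2 * cmod ?C"
    by (simp only: sum_cmod_diff_square cnj_exp_argument_mult B_def) simp
  \<comment> \<open>Switching off costs \<open>\<rho> * B - \<eta> * h\<close>, and switching on
    with the aligned phase costs \<open>J\<close> more. The threshold rule picks the cheaper option;
    at \<open>J = 0\<close> they tie and \<open>s = 1\<close>.\<close>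
  have own: "u * s - \<eta> * ((1 - s)\<^sup>2 * h) + \<rho> * (\<Sum>m=0..2. (cmod (c m - t'))\<^sup>2)
      = \<rho> * B - \<eta> * h + min 0 J"
  proof (cases "J > 0")
    case True
    then have "s = 0" "t' = 0" using s t' by simp_all
    then show ?thesis using True by (simp only: zero) simp
  next
    case False
    then have "s = 1" "t' = ?e" using s t' by simp_all
    then show ?thesis using False by (simp only: opt) (simp add: J algebra_simps)
  qed
  \<comment> \<open>The constraint |t|^2 = r leaves only the origin or the unit circle.\<close>
  consider "r = 0" "t = 0" | "r = 1" "cmod t = 1"
    using assms(2,3) by (auto simp: abs_square_eq_1)
  then show ?thesis
  proof cases
    case 1
    then show ?thesis unfolding own by (simp only: zero) simp
  next
    case 2
    \<comment> \<open>The left side plus \<open>u\<close> equals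
      \<open>\<rho> * B - \<eta> * h + J\<close>, so the claim reduces to
      \<open>min 0 J \<le> J\<close>.\<close>
    have "\<rho> * (B + 3 - 2 * cmod ?C) \<le> \<rho> * (\<Sum>m=0..2. (cmod (c m - t))\<^sup>2)"
      using penalty_argument_le [OF 2(2), where A = "{0..2}" and c = c and a = a] \<open>\<rho> > 0\<close> unfolding opt by simp
    then show ?thesis unfolding own by (simp add: 2 J algebra_simps)
  qed
qed

theorem mainTheorem2:
  fixes \<rho> u \<eta> arg0 :: real
    and G :: "complex^'n^'r"
    and w :: "complex^1^'n"
    and g :: "complex^1^'r"
    and x \<mu> :: "nat \<Rightarrow> complex^('r option)"
    and J :: "'r \<Rightarrow> real"
    and s :: "real^'r"
    and \<theta> :: "complex^('r option)"
  assumes "\<rho> > 0" and "u > 0" and "\<eta> > 0"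
    and "g = G ** w"
    and "\<And>i. J i = \<eta> * (cmod (g $ i $ 1))\<^sup>2 + u + 3 * \<rho>
                  - 2 * \<rho> * cmod (\<Sum>m=0..2. x m $ Some i + \<mu> m $ Some i)"
    and "\<And>i. s $ i = (if J i > 0 then 0 else 1)"
    and "\<And>i. \<theta> $ Some i = of_real (s $ i) *
               exp (\<i> * of_real (argument arg0 (\<Sum>m=0..2. x m $ Some i + \<mu> m $ Some i)))"
    and "\<theta> $ None = exp (\<i> * of_real (argument arg0 (\<Sum>m=0..2. x m $ None + \<mu> m $ None)))"
  shows "is_arg_min (\<lambda>(S, \<phi>). objective \<rho> u \<eta> G w x \<mu> S \<phi>) (\<lambda>(S, \<phi>). feasible S \<phi>) (diag s, \<theta>)"
proof -
  \<comment> \<open>The exponentials have modulus 1, so |\<theta>_i|^2 is the square of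
    \<open>s $ i\<close>, which is \<open>s $ i\<close> itself for values 0 and 1.\<close>
  have "feasible (diag s) \<theta>"
    unfolding feasible_def using assms(6-8) by (auto simp: norm_mult split: if_splits intro!: exI [of _ s])
  moreover have "objective \<rho> u \<eta> G w x \<mu> (diag s) \<theta> \<le> objective \<rho> u \<eta> G w x \<mu> S \<phi>"
    if feas: "feasible S \<phi>" for S \<phi>
  proof -
    obtain r where r: "S = diag r" "\<And>i. r $ i \<in> {0, 1}" "\<And>i. (cmod (\<phi> $ Some i))\<^sup>2 = r $ i"
      and "(cmod (\<phi> $ None))\<^sup>2 = 1"
      using feas unfolding feasible_def by blast
    then have None: "cmod (\<phi> $ None) = 1"
      by (simp add: abs_square_eq_1)
    show ?thesis
      unfolding r(1) objective_diag assms(8)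
    \<comment> \<open>The last index has no on/off choice and contributes only a penalty on the unit
      circle, so phase alignment settles it; the other indices are compared term by term.\<close>
    proof (rule add_mono [OF sum_mono mult_left_mono [OF penalty_argument_le [OF None]]])
      show "0 \<le> \<rho>" using \<open>\<rho> > 0\<close> by simp
    next
      fix i
      show "u * s $ i - \<eta> * ((1 - s $ i)\<^sup>2 * (cmod ((G ** w) $ i $ 1))\<^sup>2)
              + \<rho> * (\<Sum>m=0..2. (cmod (x m $ Some i + \<mu> m $ Some i - \<theta> $ Some i))\<^sup>2)
            \<le> u * r $ i - \<eta> * ((1 - r $ i)\<^sup>2 * (cmod ((G ** w) $ i $ 1))\<^sup>2)
              + \<rho> * (\<Sum>m=0..2. (cmod (x m $ Some i + \<mu> m $ Some i - \<phi> $ Some i))\<^sup>2)"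
        by (rule element_cost_le [OF \<open>\<rho> > 0\<close> r(2,3) assms(5) [of i, unfolded assms(4)]
              assms(6,7)])
    qed
  qed
  ultimately show ?thesis
    by (auto simp: is_arg_min_linorder)
qed

end
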